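(* Let $f:\mathbb{R}^k\to\mathbb{R}$ be twice differentiable, $L$-smooth ($L>0$) and convex, with a minimizer $x^*$. Let $0<\alpha<1$, $\beta\in\mathbb{R}$, $\gamma=\frac{1-\alpha}{2-\alpha}$, and set $$K_1=\tfrac{L}{2}(\beta-\gamma),\qquad K_2=\begin{cases}\tfrac{L}{2}(\beta+\gamma)&\text{if }\beta\ge0,\\ -\tfrac{L}{2}(\beta-\gamma)&\text{if }\beta\le0.\end{cases}$$ Let $(s_t)_{t\ge0}$ be real numbers with $s_0>\sqrt5+2$ and $$\frac{(s_{t+1}+1)^2}{s_{t+1}^2-4s_{t+1}-1}+\frac{2}{s_{t+1}}\le\frac{(s_t+1)^2}{s_t^2-4s_t-1}\qquad\text{for all }t\ge0,$$ and let $(\lambda_t)_{t\ge0}$ be real numbers with $1-\lambda_tK_1=s_t|\lambda_t|K_2$ for all $t\ge0$. Let $x_0\in\mathbb{R}^k$ and define, for $t\ge0$, $$x_{t+1}=x_t-\eta_t\,{}^{C}\delta^{\alpha,\beta}_{c_t}f(x_t),\qquad x_t-c_t=-\lambda_t\nabla f(x_t),$$ $$\eta_t=\frac1L\left[\frac{2(1-\lambda_tK_1-|\lambda_t|K_2)}{(1-\lambda_tK_1+|\lambda_t|K_2)^2}-\frac{1}{1-\lambda_tK_1}\right]=\frac{1}{L(1-\lambda_tK_1)}\left[\frac{s_t^2-4s_t-1}{(s_t+1)^2}\right].$$ For $T\ge1$ let $\bar x_T=\frac1T\sum_{t=1}^Tx_t$. Then the method achieves the following $O(1/T)$ convergence rate: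 $$f(\bar x_T)-f(x^* )\le\frac L2\left[\frac{(s_0+1)^2}{s_0^2-4s_0-1}+\frac{2}{s_0}\right]\frac{\|x_0-x^*\|_2^2}{T}.$$ In particular, however, this rate is at best the same as that of gradient descent: the coefficient of $\frac{\|x_0-x^*\|_2^2}{T}$ is at least $\frac L2$, the coefficient in gradient descent's rate.
   Context: $x^{(i)}$ denotes the $i$th coordinate of $x\in\mathbb{R}^k$. $f:\mathbb{R}^k\to\mathbb{R}$ is $L$-smooth if $|f(y)-f(x)-\langle\nabla f(x),y-x\rangle|\le\frac L2\|y-x\|_2^2$ for all $x,y$. For $g:\mathbb{R}\to\mathbb{R}$, non-integer $\nu>0$, $n=\lceil\nu\rceil$ and real $x\ne c$, the Caputo derivative is $${}^{C}D^{\nu}_{c}g(x)=\frac{(\operatorname{sgn}(x-c))^{n-1}}{\Gamma(n-\nu)}\int_c^x\frac{g^{(n)}(t)}{|x-t|^{\nu-n+1}}\,dt ,$$ with $\operatorname{sgn}$ the sign function, $\Gamma$ the gamma function, and $\int_c^x$ the oriented integral. For $\alpha\in(0,1)$, $\beta\in\mathbb{R}$, real $x\neq c$, $${}^{C}\delta^{\alpha,\beta}_{c}g(x)=\frac{\Gamma(2-\alpha)|x-c|^{\alpha}}{x-c}\Big({}^{C}D^{\alpha}_{c}g(x)+\beta|x-c|\,{}^{C}D^{1+\alpha}_{c}g(x)\Big),$$ and for $c=x$ it is read as its limiting value $g'(x)$. For $f:\mathbb{R}^k\to\mathbb{R}$ and $x,c\in\mathbb{R}^k$, $${}^{C}\delta^{\alpha,\beta}_{c}f(x)=\big[{}^{C}\delta^{\alpha,\beta}_{c^{(1)}}f_{1,x}(x^{(1)}),\dots,{}^{C}\delta^{\alpha,\beta}_{c^{(k)}}f_{k,x}(x^{(k)})\big],\qquad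 f_{j,x}(y)=f\big(x+(y-x^{(j)})e^{(j)}\big),$$ where $e^{(j)}$ is the $j$th standard unit vector.
   Formalization: The formal theorem assumes s_t > √5+2 for every t, not only for s_0; without this the claim fails, e.g. for k=1, f(x)=x²/2, L=1, α=1/2, β=0, s_0=5, s_t=−1/2 for t≥1, where the bound is violated at T=2. *)

theory Defs
  imports "HOL-Analysis.Analysis"
begin

definition grad :: "('a::real_inner \<Rightarrow> real) \<Rightarrow> 'a \<Rightarrow> 'a" where
  "grad f x = (THE D. GDERIV f x :> D)"

lemma grad_eqI:
  assumes "GDERIV f x :> D"
  shows "grad f x = D"
  unfolding grad_def
proof (rule the_equality)
  fix D' assume "GDERIV f x :> D'"
  with assms have "(\<lambda>h. inner h D') = (\<lambda>h. inner h D)"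
    unfolding gderiv_def by (metis has_derivative_unique)
  then have "inner (D' - D) D' = inner (D' - D) D"
    by (rule fun_cong)
  then have "inner (D' - D) (D' - D) = 0"
    by (simp add: inner_diff_right)
  then show "D' = D"
    by simp
qed (fact assms)

definition twice_differentiable :: "('a::real_inner \<Rightarrow> real) \<Rightarrow> bool" where
  "twice_differentiable f \<longleftrightarrow>
     (\<forall>x. f differentiable (at x)) \<and> (\<forall>x. grad f differentiable (at x))"

definition L_smooth :: "real \<Rightarrow> ('a::real_inner \<Rightarrow> real) \<Rightarrow> bool" where
  "L_smooth L f \<longleftrightarrow>
     (\<forall>x y. \<bar>f y - f x - grad f x \<bullet> (y - x)\<bar> \<le> L / 2 * (norm (y - x))\<^sup>2)"

text \<open>
  Caputo derivative of order \<open>\<nu>\<close> with terminal \<open>c\<close>, for non-integer \<open>\<nu> > 0\<close> and \<open>x \<noteq> c\<close>.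
  The interval integral is oriented: it changes sign when \<open>x < c\<close>.
\<close>
definition caputo :: "real \<Rightarrow> real \<Rightarrow> (real \<Rightarrow> real) \<Rightarrow> real \<Rightarrow> real" where
  "caputo \<nu> c g x =
     (let n = nat \<lceil>\<nu>\<rceil> in
        sgn (x - c) ^ (n - 1) / Gamma (real n - \<nu>) *
        (LBINT t=ereal c..ereal x. (deriv ^^ n) g t / \<bar>x - t\<bar> powr (\<nu> - real n + 1)))"

text \<open>For \<open>c = x\<close> the operator is read as its limiting value, the ordinary derivative.\<close>
definition caputo_delta ::
    "real \<Rightarrow> real \<Rightarrow> real \<Rightarrow> (real \<Rightarrow> real) \<Rightarrow> real \<Rightarrow> real" where
  "caputo_delta \<alpha> \<beta> c g x =
     (if x = c then deriv g x
      else Gamma (2 - \<alpha>) * \<bar>x - c\<bar> powr \<alpha> / (x - c) *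
           (caputo \<alpha> c g x + \<beta> * \<bar>x - c\<bar> * caputo (1 + \<alpha>) c g x))"

definition caputo_grad ::
    "real \<Rightarrow> real \<Rightarrow> real ^ 'k \<Rightarrow> (real ^ 'k \<Rightarrow> real) \<Rightarrow> real ^ 'k \<Rightarrow> real ^ 'k" where
  "caputo_grad \<alpha> \<beta> c f x =
     (\<chi> j. caputo_delta \<alpha> \<beta> (c $ j) (\<lambda>y. f (x + (y - x $ j) *\<^sub>R axis j 1)) (x $ j))"

end

theory Submission
  imports Defs
begin

text \<open>
  The Caputo direction is an inexact gradient with an explicit bound on its relative error.
  In one variable, with \<open>h = \<bar>x - c\<bar>\<close>, the fractional derivatives of orders \<open>\<alpha>\<close> and \<open>1 + \<alpha>\<close> are
  integrals of \<open>g'\<close> and \<open>g''\<close> over the segment from \<open>c\<close> to \<open>x\<close> against the integrable weight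
  \<open>\<bar>x - t\<bar> powr (- \<alpha>)\<close>.  Convexity and smoothness say that \<open>g''\<close> lies in \<open>[0, L]\<close> and that
  \<open>g' x - g' t\<close> lies between \<open>0\<close> and \<open>L * (x - t)\<close>.  Integrating these sandwiches gives
  \<open>caputo_delta = g' x + (x - c) * (\<beta> * v - u)\<close> with \<open>0 \<le> u \<le> L * \<gamma>\<close> and \<open>0 \<le> v \<le> L\<close>.  The
  numbers \<open>K1\<close> and \<open>K2\<close> are the midpoint and the half-length of the interval in which
  \<open>\<beta> * v - u\<close> then lies; the sign of \<open>\<beta>\<close> decides its end points
  (\<open>caputo_delta_near_derivative\<close>).

  Coordinatewise, and with \<open>x - c = - \<lambda> \<nabla>f x\<close>, the direction \<open>d\<close> satisfies
  \<open>norm (d - a \<nabla>f x) \<le> b norm (\<nabla>f x)\<close> where \<open>a = 1 - \<lambda> K1\<close> and \<open>b = \<bar>\<lambda>\<bar> K2 = a / s\<close>.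
  The step size \<open>\<eta>\<close> is the one for which, in the usual gradient descent argument, all multiples of
  \<open>(norm (\<nabla>f x))\<^sup>2\<close> cancel.  What is left is a difference of squared distances
  \<open>D t = (norm (x t - xstar))\<^sup>2\<close> and one error term \<open>L * D t / s t\<close>, which comes from the inner
  product of \<open>d - a \<nabla>f x\<close> with \<open>x - xstar\<close> (\<open>inexact_gradient_step\<close>).  With
  \<open>R t = (s t + 1)\<^sup>2 / ((s t)\<^sup>2 - 4 * s t - 1)\<close> this reads
  \<open>f (x (t + 1)) - f xstar \<le> L / 2 * ((R t + 2 / s t) * D t - R t * D (t + 1))\<close>,
  and the recursion imposed on \<open>s\<close> is exactly what makes the sum over \<open>t\<close> telescope.  Jensen's
  inequality turns the sum into a bound at the average iterate.  The coefficient is at least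
  \<open>L / 2\<close> because \<open>R t \<ge> 1\<close>.
\<close>

section \<open>Integrals against a power weight\<close>

text \<open>
  Both orientations of the segment reduce to the integral of \<open>r powr p\<close> over \<open>{0<..<h}\<close> by the
  substitution \<open>t = x - sgn (x - c) * r\<close>.
\<close>
lemma has_bochner_integral_abs_powr_segment:
  fixes c x p :: real
  assumes p: "p > -1" and "x \<noteq> c"
  shows "has_bochner_integral lborel (\<lambda>t. indicator (open_segment c x) t *\<^sub>R \<bar>x - t\<bar> powr p)
           (\<bar>x - c\<bar> powr (p + 1) / (p + 1))"
proof -
  define h where "h = \<bar>x - c\<bar>"
  define e where "e = sgn (x - c)"
  have h: "h > 0" and e: "e = 1 \<or> e = -1" "x - c = e * h"
    using assms by (auto simp: h_def e_def sgn_if)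
  let ?k = "\<lambda>r. indicator {0<..<h} r *\<^sub>R \<bar>r\<bar> powr p :: real"
  have "((\<lambda>r. r powr p) has_integral (h powr (p + 1) / (p + 1))) {0..h}"
    using has_integral_powr_from_0[OF p, of h] h by simp
  then have "((\<lambda>r. r powr p) has_integral (h powr (p + 1) / (p + 1))) {0<..<h}"
    by (simp add: has_integral_Icc_iff_Ioo)
  then have "((\<lambda>r. if r \<in> {0<..<h} then r powr p else 0) has_integral (h powr (p + 1) / (p + 1))) UNIV"
    by (simp only: has_integral_restrict_UNIV)
  then have "(?k has_integral (h powr (p + 1) / (p + 1))) UNIV"
    by (rule has_integral_eq[rotated]) (auto simp: indicator_def)
  then have "integral\<^sup>N lborel ?k = h powr (p + 1) / (p + 1)"
    by (intro nn_integral_has_integral_lborel) auto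
  then have k: "has_bochner_integral lborel ?k (h powr (p + 1) / (p + 1))"
    using p by (intro has_bochner_integral_nn_integral) auto
  have "(\<lambda>r. indicator (open_segment c x) (x + (- e) * r) *\<^sub>R \<bar>x - (x + (- e) * r)\<bar> powr p) = ?k"
    using e h by (auto simp: fun_eq_iff indicator_def open_segment_eq_real_ivl)
  then show ?thesis
    using k e unfolding h_def[symmetric]
    by (subst lborel_has_bochner_integral_real_affine_iff[of "- e" _ _ x]) auto
qed

text \<open>
  Separating the orientation from the domain lets both cases \<open>c < x\<close> and \<open>x < c\<close> be treated by one
  computation over the unoriented segment.
\<close>
lemma interval_integral_eq_segment:
  fixes c x :: real and F :: "real \<Rightarrow> real"
  shows "(LBINT t=ereal c..ereal x. F t) = sgn (x - c) * (LINT t:open_segment c x|lborel. F t)"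
  by (auto simp: interval_lebesgue_integral_def open_segment_eq_real_ivl sgn_if set_lebesgue_integral_def)

text \<open>
  A pointwise sandwich on \<open>\<phi>\<close> gives both integrability (by domination) and the bounds.  The factor
  \<open>\<bar>x - t\<bar> powr q\<close> covers the two uses: \<open>q = 0\<close> for the second derivative and \<open>q = 1\<close> for an
  increment of the first derivative.
\<close>
lemma weighted_integral_bounds:
  fixes c x p q L :: real and \<phi> :: "real \<Rightarrow> real"
  assumes p: "p > -1" and q: "q \<ge> 0" and "x \<noteq> c"
    and \<phi> [measurable]: "\<phi> \<in> borel_measurable borel"
    and bnd: "\<And>t. t \<in> open_segment c x \<Longrightarrow> 0 \<le> \<phi> t \<and> \<phi> t \<le> L * \<bar>x - t\<bar> powr q"
  shows "set_integrable lborel (open_segment c x) (\<lambda>t. \<bar>x - t\<bar> powr p * \<phi> t)" (is ?int)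
    and "(LINT t:open_segment c x|lborel. \<bar>x - t\<bar> powr p * \<phi> t)
           \<in> {0 .. L * (\<bar>x - c\<bar> powr (p + q + 1) / (p + q + 1))}" (is ?bnd)
proof -
  let ?S = "open_segment c x"
  have [measurable]: "?S \<in> sets borel"
    by (simp add: open_segment_eq_real_ivl)
  have W: "has_bochner_integral lborel (\<lambda>t. indicator ?S t *\<^sub>R \<bar>x - t\<bar> powr (p + q))
             (\<bar>x - c\<bar> powr (p + q + 1) / (p + q + 1))"
    using assms by (intro has_bochner_integral_abs_powr_segment) auto
  then have W_int: "set_integrable lborel ?S (\<lambda>t. L * \<bar>x - t\<bar> powr (p + q))"
    by (intro set_integrable_mult_right) (simp add: set_integrable_def has_bochner_integral_iff)
  have W_eq: "(LINT t:?S|lborel. L * \<bar>x - t\<bar> powr (p + q)) = L * (\<bar>x - c\<bar> powr (p + q + 1) / (p + q + 1))"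
    using W by (simp add: set_lebesgue_integral_def has_bochner_integral_iff)
  have le: "0 \<le> \<bar>x - t\<bar> powr p * \<phi> t" "\<bar>x - t\<bar> powr p * \<phi> t \<le> L * \<bar>x - t\<bar> powr (p + q)"
    if "t \<in> ?S" for t
    using bnd[OF that] mult_left_mono[of "\<phi> t" "L * \<bar>x - t\<bar> powr q" "\<bar>x - t\<bar> powr p"]
    by (auto simp: powr_add mult_ac)
  show int: ?int
  proof (rule set_integrable_bound[OF W_int])
    show "set_borel_measurable lborel ?S (\<lambda>t. \<bar>x - t\<bar> powr p * \<phi> t)"
      unfolding set_borel_measurable_def by measurable
  qed (use le in \<open>auto intro!: AE_I2 order_trans[OF _ abs_ge_self] simp del: abs_mult\<close>)
  show ?bnd
    using set_integral_mono[OF int W_int] le W_eq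
    by (auto simp: set_lebesgue_integral_def indicator_def intro!: integral_nonneg_AE AE_I2)
qed

text \<open>
  A derivative is a pointwise limit of continuous difference quotients.  This is needed for \<open>g''\<close>,
  which exists everywhere but may be discontinuous.
\<close>
lemma borel_measurable_has_real_derivative:
  fixes g g' :: "real \<Rightarrow> real"
  assumes "\<And>t. (g has_real_derivative g' t) (at t)"
  shows "g' \<in> borel_measurable borel"
proof (rule borel_measurable_LIMSEQ_real)
  have [measurable]: "g \<in> borel_measurable borel"
    using assms by (intro borel_measurable_continuous_onI)
      (auto simp: continuous_on_eq_continuous_at intro: DERIV_isCont)
  show "(\<lambda>t. (g (t + inverse (real (Suc i))) - g t) / inverse (real (Suc i))) \<in> borel_measurable borel" for i
    by measurable
  show "(\<lambda>i. (g (t + inverse (real (Suc i))) - g t) / inverse (real (Suc i))) \<longlonglongrightarrow> g' t" for t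
  proof -
    have "filterlim (\<lambda>i. inverse (real (Suc i))) (at 0) sequentially"
      using LIMSEQ_inverse_real_of_nat by (auto simp: filterlim_at)
    then show ?thesis
      using assms[of t] unfolding DERIV_def by (rule filterlim_compose[rotated])
  qed
qed

section \<open>The one-dimensional Caputo operator\<close>

text \<open>
  The oriented integral contributes \<open>sgn (x - c)\<close>.  In the term of order \<open>\<alpha>\<close> it turns
  \<open>1 / (x - c)\<close> into \<open>1 / \<bar>x - c\<bar>\<close>; in the term of order \<open>1 + \<alpha>\<close> it cancels the sign factor in
  the definition of the derivative.  The gamma factors leave
  \<open>\<Gamma>(2 - \<alpha>) / \<Gamma>(1 - \<alpha>) = 1 - \<alpha>\<close>.
\<close>
lemma caputo_delta_eq_weighted_integrals:
  assumes "0 < \<alpha>" "\<alpha> < 1" "x \<noteq> c"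
  shows "caputo_delta \<alpha> \<beta> c g x = (1 - \<alpha>) * \<bar>x - c\<bar> powr (\<alpha> - 1) *
     ((LINT t:open_segment c x|lborel. \<bar>x - t\<bar> powr (- \<alpha>) * deriv g t)
      + \<beta> * (x - c) * (LINT t:open_segment c x|lborel. \<bar>x - t\<bar> powr (- \<alpha>) * deriv (deriv g) t))"
proof -
  let ?S = "open_segment c x"
  define A where "A = (LINT t:?S|lborel. \<bar>x - t\<bar> powr (- \<alpha>) * deriv g t)"
  define B where "B = (LINT t:?S|lborel. \<bar>x - t\<bar> powr (- \<alpha>) * deriv (deriv g) t)"
  have n: "nat \<lceil>\<alpha>\<rceil> = 1" "nat \<lceil>1 + \<alpha>\<rceil> = 2"
    using assms by (auto simp: ceiling_eq_iff nat_eq_iff)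
  have powr: "a / b powr q = b powr (- q) * a" for a b q :: real
    by (simp add: powr_minus_divide)
  have G: "Gamma (2 - \<alpha>) = (1 - \<alpha>) * Gamma (1 - \<alpha>)"
  proof -
    have "1 - \<alpha> \<notin> \<int>\<^sub>\<le>\<^sub>0"
      using assms by (auto dest: nonpos_Ints_nonpos)
    then show ?thesis
      using Gamma_plus1[of "1 - \<alpha>"] by (simp add: algebra_simps)
  qed
  have G0: "Gamma (1 - \<alpha>) \<noteq> 0"
    using assms Gamma_real_pos[of "1 - \<alpha>"] by linarith
  have A: "caputo \<alpha> c g x = sgn (x - c) / Gamma (1 - \<alpha>) * A"
    unfolding caputo_def Let_def n interval_integral_eq_segment powr A_def by simp
  have B: "caputo (1 + \<alpha>) c g x = B / Gamma (1 - \<alpha>)"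
    using assms unfolding caputo_def Let_def n interval_integral_eq_segment powr B_def
    by (simp add: sgn_if numeral_2_eq_2)
  have cancel: "a * G * p / d * (sgn d / G * A + \<beta> * \<bar>d\<bar> * (B / G)) = a * (p / \<bar>d\<bar>) * (A + \<beta> * d * B)"
    if "G \<noteq> 0" "d \<noteq> 0" for a p d G :: real
    using that by (cases "d > 0") (simp_all add: field_simps)
  have "caputo_delta \<alpha> \<beta> c g x = (1 - \<alpha>) * Gamma (1 - \<alpha>) * \<bar>x - c\<bar> powr \<alpha> / (x - c) *
           (sgn (x - c) / Gamma (1 - \<alpha>) * A + \<beta> * \<bar>x - c\<bar> * (B / Gamma (1 - \<alpha>)))"
    using assms unfolding caputo_delta_def A B G by simp
  also have "\<dots> = (1 - \<alpha>) * (\<bar>x - c\<bar> powr \<alpha> / \<bar>x - c\<bar>) * (A + \<beta> * (x - c) * B)"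
    using assms by (intro cancel G0) auto
  also have "\<bar>x - c\<bar> powr \<alpha> / \<bar>x - c\<bar> = \<bar>x - c\<bar> powr (\<alpha> - 1)"
    using assms by (simp add: powr_diff)
  finally show ?thesis
    unfolding A_def B_def .
qed

text \<open>
  The increment condition says that \<open>u\<close> is nondecreasing and \<open>L\<close>-Lipschitz, so every difference
  quotient lies in \<open>[0, L]\<close>.
\<close>
lemma derivative_bounds_from_increment_bounds:
  fixes u :: "real \<Rightarrow> real"
  assumes u: "(u has_real_derivative u') (at t)"
    and inc: "\<And>r s. 0 \<le> (u r - u s) * (r - s) \<and> (u r - u s) * (r - s) \<le> L * (r - s)\<^sup>2"
  shows "0 \<le> u'" "u' \<le> L"
proof -
  have lim: "((\<lambda>h. (u (t + h) - u t) / h) \<longlongrightarrow> u') (at 0)"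
    using u unfolding DERIV_def .
  have q: "0 \<le> (u (t + h) - u t) / h \<and> (u (t + h) - u t) / h \<le> L" if "h \<noteq> 0" for h
  proof -
    have "(u (t + h) - u t) / h = (u (t + h) - u t) * (t + h - t) / (t + h - t)\<^sup>2"
      using that by (simp add: power2_eq_square)
    then show ?thesis
      using inc[of "t + h" t] that by (simp add: divide_le_eq)
  qed
  then have ev: "\<forall>\<^sub>F h in at 0. 0 \<le> (u (t + h) - u t) / h \<and> (u (t + h) - u t) / h \<le> L"
    by (auto simp: eventually_at_filter)
  show "0 \<le> u'"
    by (rule tendsto_lowerbound[OF lim]) (use ev in \<open>auto elim: eventually_mono\<close>)
  show "u' \<le> L"
    by (rule tendsto_upperbound[OF lim]) (use ev in \<open>auto elim: eventually_mono\<close>)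
qed

text \<open>
  For \<open>c = x\<close> the operator is the derivative itself.  Otherwise the deviation from \<open>g' x\<close> is
  \<open>(x - c) * (\<beta> * v - u)\<close>, where \<open>u\<close> is a weighted average of \<open>(g' x - g' t) / (x - c)\<close> and
  \<open>v\<close> a weighted average of \<open>g'' t\<close>.  For \<open>\<beta> \<ge> 0\<close> the bracket lies in \<open>[- L * \<gamma>, L * \<beta>]\<close>, for
  \<open>\<beta> < 0\<close> in \<open>[L * \<beta> - L * \<gamma>, 0]\<close>; in both cases \<open>K1\<close> is the midpoint and \<open>K2\<close> the half-length.
\<close>
lemma caputo_delta_near_derivative:
  fixes g g' g'' :: "real \<Rightarrow> real"
  assumes \<alpha>: "0 < \<alpha>" "\<alpha> < 1"
    and g': "\<And>t. (g has_real_derivative g' t) (at t)"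
    and g'': "\<And>t. (g' has_real_derivative g'' t) (at t)"
    and inc: "\<And>r s. 0 \<le> (g' r - g' s) * (r - s) \<and> (g' r - g' s) * (r - s) \<le> L * (r - s)\<^sup>2"
    and \<gamma>: "\<gamma> = (1 - \<alpha>) / (2 - \<alpha>)"
    and K1: "K1 = L / 2 * (\<beta> - \<gamma>)"
    and K2: "K2 = (if \<beta> \<ge> 0 then L / 2 * (\<beta> + \<gamma>) else - (L / 2) * (\<beta> - \<gamma>))"
  shows "\<bar>caputo_delta \<alpha> \<beta> c g x - (g' x + K1 * (x - c))\<bar> \<le> K2 * \<bar>x - c\<bar>"
proof (cases "x = c")
  case True
  then show ?thesis
    using g'[of x] by (simp add: caputo_delta_def DERIV_imp_deriv)
next
  case xc: False
  let ?S = "open_segment c x"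
  define h where "h = \<bar>x - c\<bar>"
  define e where "e = sgn (x - c)"
  have h: "h > 0" and e: "e * e = 1" "x - c = e * h"
    using xc by (auto simp: h_def e_def sgn_if)
  have derivs: "deriv g = g'" "deriv g' = g''"
    using g' g'' by (auto simp: fun_eq_iff intro: DERIV_imp_deriv)
  have [measurable]: "g' \<in> borel_measurable borel" "g'' \<in> borel_measurable borel"
    using g' g'' by (auto intro: borel_measurable_has_real_derivative)
  let ?w = "\<lambda>t. \<bar>x - t\<bar> powr (- \<alpha>)"
  have ne: "x - t = e * \<bar>x - t\<bar>" "x \<noteq> t" if "t \<in> ?S" for t
    using that by (auto simp: open_segment_eq_real_ivl e_def sgn_if split: if_splits)
  define I1 where "I1 = (LINT t:?S|lborel. ?w t * (e * (g' x - g' t)))"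
  define I2 where "I2 = (LINT t:?S|lborel. ?w t * g'' t)"
  have b1: "0 \<le> e * (g' x - g' t) \<and> e * (g' x - g' t) \<le> L * \<bar>x - t\<bar> powr 1" if "t \<in> ?S" for t
  proof -
    have pos: "0 < \<bar>x - t\<bar>"
      using ne[OF that] by simp
    have "(g' x - g' t) * (x - t) = (e * (g' x - g' t)) * \<bar>x - t\<bar>"
      using arg_cong[OF ne(1)[OF that], of "\<lambda>d. (g' x - g' t) * d"] by (simp only: ac_simps)
    then have "0 \<le> (e * (g' x - g' t)) * \<bar>x - t\<bar>"
      "(e * (g' x - g' t)) * \<bar>x - t\<bar> \<le> (L * \<bar>x - t\<bar>) * \<bar>x - t\<bar>"
      using inc[of x t] abs_mult_self_eq[of "x - t"] by (metis, metis mult.assoc power2_eq_square)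
    then show ?thesis
      using pos by (simp add: zero_le_mult_iff)
  qed
  \<comment> \<open>The two weighted integrals have scales \<open>h powr (2 - \<alpha>)\<close> and \<open>h powr (1 - \<alpha>)\<close>.\<close>
  note J1 = weighted_integral_bounds[of "- \<alpha>" 1 x c "\<lambda>t. e * (g' x - g' t)" L, OF _ _ xc _ b1]
  have b2: "0 \<le> g'' t \<and> g'' t \<le> L * \<bar>x - t\<bar> powr 0" if "t \<in> ?S" for t
    using derivative_bounds_from_increment_bounds[OF g'' inc] ne[OF that] by auto
  note J2 = weighted_integral_bounds[of "- \<alpha>" 0 x c g'' L, OF _ _ xc _ b2]
  have I1: "0 \<le> I1" "I1 \<le> L * (h powr (2 - \<alpha>) / (2 - \<alpha>))"
    using J1(2) \<alpha> by (auto simp: I1_def h_def add.commute)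
  have I2: "0 \<le> I2" "I2 \<le> L * (h powr (1 - \<alpha>) / (1 - \<alpha>))"
    using J2(2) \<alpha> by (auto simp: I2_def h_def)
  have W: "has_bochner_integral lborel (\<lambda>t. indicator ?S t *\<^sub>R ?w t) (h powr (1 - \<alpha>) / (1 - \<alpha>))"
    using has_bochner_integral_abs_powr_segment[of "- \<alpha>" x c] xc \<alpha> by (simp add: h_def)
  have W_int: "set_integrable lborel ?S ?w" and W_eq: "(LINT t:?S|lborel. ?w t) = h powr (1 - \<alpha>) / (1 - \<alpha>)"
    using W by (auto simp: set_integrable_def set_lebesgue_integral_def has_bochner_integral_iff)
  have int1: "set_integrable lborel ?S (\<lambda>t. ?w t * (e * (g' x - g' t)))"
    using J1(1) \<alpha> by simp
  have "(LINT t:?S|lborel. ?w t * g' t)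
      = (LINT t:?S|lborel. g' x * ?w t - e * (?w t * (e * (g' x - g' t))))"
  proof (rule arg_cong[where f = "set_lebesgue_integral lborel ?S"], rule ext)
    fix t
    have "g' x * ?w t - e * (?w t * (e * (g' x - g' t))) = g' x * ?w t - (e * e) * (?w t * (g' x - g' t))"
      by (simp only: ac_simps)
    then show "?w t * g' t = g' x * ?w t - e * (?w t * (e * (g' x - g' t)))"
      by (simp add: e(1) algebra_simps)
  qed
  also have "\<dots> = g' x * (h powr (1 - \<alpha>) / (1 - \<alpha>)) - e * I1"
    using W_int int1 by (simp add: set_integral_diff W_eq I1_def)
  finally have A: "(LINT t:?S|lborel. ?w t * g' t) = g' x * (h powr (1 - \<alpha>) / (1 - \<alpha>)) - e * I1" .
  \<comment> \<open>The normalisation makes the bounds on \<open>u\<close> and \<open>v\<close> independent of \<open>h\<close>: the upper bound of \<open>I1\<close>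
    becomes \<open>L * (1 - \<alpha>) / (2 - \<alpha>) = L * \<gamma>\<close>.\<close>
  define u where "u = (1 - \<alpha>) * h powr (\<alpha> - 2) * I1"
  define v where "v = (1 - \<alpha>) * h powr (\<alpha> - 1) * I2"
  have hp: "h powr (\<alpha> - 2) * h powr (2 - \<alpha>) = 1" "h powr (\<alpha> - 1) * h powr (1 - \<alpha>) = 1"
    using h by (simp_all flip: powr_add)
  have "u \<le> (1 - \<alpha>) * h powr (\<alpha> - 2) * (L * (h powr (2 - \<alpha>) / (2 - \<alpha>)))"
    unfolding u_def using I1 \<alpha> by (intro mult_left_mono) auto
  also have "\<dots> = L * \<gamma> * (h powr (\<alpha> - 2) * h powr (2 - \<alpha>))"
    by (simp add: \<gamma>)
  finally have u: "0 \<le> u" "u \<le> L * \<gamma>"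
    using I1 \<alpha> by (simp_all add: hp u_def)
  have "v \<le> (1 - \<alpha>) * h powr (\<alpha> - 1) * (L * (h powr (1 - \<alpha>) / (1 - \<alpha>)))"
    unfolding v_def using I2 \<alpha> by (intro mult_left_mono) auto
  also have "\<dots> = L * (h powr (\<alpha> - 1) * h powr (1 - \<alpha>))"
    using \<alpha> by simp
  finally have v: "0 \<le> v" "v \<le> L"
    using I2 \<alpha> by (simp_all add: hp v_def)
  have h1: "h powr (\<alpha> - 1) = h * h powr (\<alpha> - 2)"
    using h powr_add[of h 1 "\<alpha> - 2"] by simp
  have "caputo_delta \<alpha> \<beta> c g x = (1 - \<alpha>) * h powr (\<alpha> - 1) *
     (g' x * (h powr (1 - \<alpha>) / (1 - \<alpha>)) - e * I1 + \<beta> * (x - c) * I2)"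
    unfolding caputo_delta_eq_weighted_integrals[OF \<alpha> xc] derivs A I2_def h_def ..
  also have "\<dots> = g' x * (h powr (\<alpha> - 1) * h powr (1 - \<alpha>))
      - (1 - \<alpha>) * (e * h) * h powr (\<alpha> - 2) * I1 + \<beta> * (x - c) * v"
    using \<alpha> by (simp add: v_def h1 field_simps)
  also have "\<dots> = g' x + (x - c) * (\<beta> * v - u)"
    unfolding hp e(2)[symmetric] by (simp add: u_def algebra_simps)
  finally have "caputo_delta \<alpha> \<beta> c g x - (g' x + K1 * (x - c)) = (x - c) * (\<beta> * v - u - K1)"
    by (simp add: algebra_simps)
  moreover have "\<bar>\<beta> * v - u - K1\<bar> \<le> K2"
  proof (cases "\<beta> \<ge> 0")
    case True
    then have "0 \<le> \<beta> * v" "\<beta> * v \<le> \<beta> * L"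
      using v by (auto intro: mult_left_mono)
    then show ?thesis
      using u True by (auto simp: K1 K2 abs_le_iff field_simps)
  next
    case False
    then have "\<beta> * v \<le> 0" "\<beta> * L \<le> \<beta> * v"
      using v by (auto simp: mult_nonpos_nonneg intro: mult_left_mono_neg)
    moreover have "K1 = (\<beta> * L - L * \<gamma>) / 2" "K2 = (L * \<gamma> - \<beta> * L) / 2"
      using False by (simp_all add: K1 K2 algebra_simps diff_divide_distrib)
    ultimately have "\<beta> * v - u - K1 \<le> K2" "- (\<beta> * v - u - K1) \<le> K2"
      using u by argo+
    then show ?thesis
      by (rule abs_leI)
  qed
  then have "\<bar>x - c\<bar> * \<bar>\<beta> * v - u - K1\<bar> \<le> \<bar>x - c\<bar> * K2"
    by (rule mult_left_mono) simp
  ultimately show ?thesis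
    by (simp only: abs_mult mult.commute)
qed

section \<open>Gradients of smooth convex functions\<close>

text \<open>
  In finite dimension the derivative, a linear functional, is represented by the vector
  \<open>adjoint F 1\<close>, so differentiability yields a gradient.
\<close>
lemma gderiv_grad:
  fixes f :: "'a::euclidean_space \<Rightarrow> real"
  assumes "f differentiable (at x)"
  shows "GDERIV f x :> grad f x"
proof -
  obtain F where F: "(f has_derivative F) (at x)"
    using assms unfolding differentiable_def by blast
  then have "linear F"
    by (rule has_derivative_linear)
  then have "F = (\<lambda>h. h \<bullet> adjoint F 1)"
    by (auto simp: adjoint_works fun_eq_iff)
  with F have "GDERIV f x :> adjoint F 1"
    by (simp add: gderiv_def)
  then show ?thesis
    using grad_eqI by metis
qed

lemma has_real_derivative_along_line:
  fixes f :: "'a::real_inner \<Rightarrow> real"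
  assumes "GDERIV f (x + (t - t0) *\<^sub>R v) :> G"
  shows "((\<lambda>t. f (x + (t - t0) *\<^sub>R v)) has_real_derivative v \<bullet> G) (at t)"
proof -
  have "((\<lambda>t. x + (t - t0) *\<^sub>R v) has_derivative (\<lambda>h. h *\<^sub>R v)) (at t)"
    by (auto intro!: derivative_eq_intros)
  from has_derivative_compose[OF this assms[unfolded gderiv_def]]
  show ?thesis
    by (simp add: has_field_derivative_def mult_commute_abs)
qed

text \<open>
  Restriction to the line through \<open>x\<close> and \<open>y\<close> reduces this to a convex function of one variable,
  compared at the parameters \<open>0\<close> and \<open>1\<close>.
\<close>
lemma convex_above_tangent_plane:
  fixes f :: "'a::real_inner \<Rightarrow> real"
  assumes convex: "convex_on UNIV f" and G: "GDERIV f x :> G"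
  shows "f x + G \<bullet> (y - x) \<le> f y"
proof -
  let ?h = "\<lambda>t. f (x + (t - 0) *\<^sub>R (y - x))"
  have "convex_on UNIV ?h"
  proof (rule convex_onI)
    fix t r s :: real assume "0 < t" "t < 1"
    then have "f ((1 - t) *\<^sub>R (x + r *\<^sub>R (y - x)) + t *\<^sub>R (x + s *\<^sub>R (y - x)))
        \<le> (1 - t) * ?h r + t * ?h s"
      using convex_onD[OF convex, of t "x + r *\<^sub>R (y - x)" "x + s *\<^sub>R (y - x)"] by simp
    also have "(1 - t) *\<^sub>R (x + r *\<^sub>R (y - x)) + t *\<^sub>R (x + s *\<^sub>R (y - x))
        = x + ((1 - t) *\<^sub>R r + t *\<^sub>R s - 0) *\<^sub>R (y - x)"
      by (simp add: algebra_simps)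
    finally show "?h ((1 - t) *\<^sub>R r + t *\<^sub>R s) \<le> (1 - t) * ?h r + t * ?h s" .
  qed auto
  then have "?h 1 - ?h 0 \<ge> ((y - x) \<bullet> G) * (1 - 0)"
    by (rule convex_on_imp_above_tangent)
      (use has_real_derivative_along_line[of f x 0 0 "y - x" G] G in auto)
  then show ?thesis
    by (simp add: inner_commute)
qed

lemma L_smooth_upper:
  assumes "L_smooth L f"
  shows "f y \<le> f x + grad f x \<bullet> (y - x) + L / 2 * (norm (y - x))\<^sup>2"
  using assms unfolding L_smooth_def by (smt (verit))

text \<open>
  Adding a tangent inequality at \<open>x\<close> to one at \<open>y\<close> cancels the function values.  Two lower bounds from
  convexity give monotonicity; two upper bounds from smoothness give the other estimate.
\<close>
lemma gradient_increment_bounds: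
  fixes f :: "'a::real_inner \<Rightarrow> real"
  assumes convex: "convex_on UNIV f" and smooth: "L_smooth L f"
    and G: "\<And>z. GDERIV f z :> grad f z"
  shows "0 \<le> (grad f x - grad f y) \<bullet> (x - y)"
    and "(grad f x - grad f y) \<bullet> (x - y) \<le> L * (norm (x - y))\<^sup>2"
proof -
  have inner: "(grad f x - grad f y) \<bullet> (x - y) = - (grad f x \<bullet> (y - x)) - grad f y \<bullet> (x - y)"
    by (simp add: algebra_simps)
  show "0 \<le> (grad f x - grad f y) \<bullet> (x - y)"
    using convex_above_tangent_plane[OF convex G, of x y] convex_above_tangent_plane[OF convex G, of y x]
    unfolding inner by linarith
  show "(grad f x - grad f y) \<bullet> (x - y) \<le> L * (norm (x - y))\<^sup>2"
  proof -
    have "f x \<le> f y + grad f y \<bullet> (x - y) + L / 2 * (norm (x - y))\<^sup>2"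
      "f y \<le> f x + grad f x \<bullet> (y - x) + L / 2 * (norm (x - y))\<^sup>2"
      using L_smooth_upper[OF smooth, of x y] L_smooth_upper[OF smooth, of y x]
      by (simp_all add: norm_minus_commute)
    then show ?thesis
      unfolding inner by linarith
  qed
qed

text \<open>
  A gradient step of length \<open>1 / L\<close> lowers \<open>f\<close> by at least \<open>(norm (grad f z))\<^sup>2 / (2 * L)\<close> but cannot go
  below the minimum.  At \<open>z = xstar\<close> this shows that the gradient vanishes there, so smoothness
  bounds the gap at \<open>x\<close> by \<open>L / 2 * (norm (x - xstar))\<^sup>2\<close>; at \<open>z = x\<close> it then bounds the gradient.
\<close>
lemma norm_grad_le_dist_minimizer:
  fixes f :: "'a::real_inner \<Rightarrow> real"
  assumes "L > 0" and smooth: "L_smooth L f" and min: "\<And>y. f xstar \<le> f y"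
  shows "norm (grad f x) \<le> L * norm (x - xstar)"
proof -
  have gap: "(norm (grad f z))\<^sup>2 \<le> 2 * L * (f z - f xstar)" for z
  proof -
    let ?g = "grad f z"
    define q where "q = (norm ?g)\<^sup>2 / L"
    have inner: "?g \<bullet> (z - (1 / L) *\<^sub>R ?g - z) = - q"
      by (simp add: q_def power2_norm_eq_inner)
    have sq: "L / 2 * (norm (z - (1 / L) *\<^sub>R ?g - z))\<^sup>2 = q / 2"
      using \<open>L > 0\<close> by (simp add: q_def power_divide power2_eq_square[of L])
    have "f xstar \<le> f (z - (1 / L) *\<^sub>R ?g)"
      by (rule min)
    also have "\<dots> \<le> f z + - q + q / 2"
      using L_smooth_upper[OF smooth, of "z - (1 / L) *\<^sub>R ?g" z] unfolding inner sq .
    finally have "q \<le> 2 * (f z - f xstar)"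
      by argo
    then have "(norm ?g)\<^sup>2 \<le> 2 * (f z - f xstar) * L"
      using \<open>L > 0\<close> unfolding q_def by (simp only: pos_divide_le_eq)
    then show ?thesis
      by (simp only: ac_simps)
  qed
  have "grad f xstar = 0"
    using gap[of xstar] by simp
  then have "f x - f xstar \<le> L / 2 * (norm (x - xstar))\<^sup>2"
    using L_smooth_upper[OF smooth, of x xstar] by simp
  then have "2 * L * (f x - f xstar) \<le> 2 * L * (L / 2 * (norm (x - xstar))\<^sup>2)"
    using \<open>L > 0\<close> by (intro mult_left_mono) auto
  also have "\<dots> = (L * norm (x - xstar))\<^sup>2"
    by (simp add: power_mult_distrib power2_eq_square)
  finally have "(norm (grad f x))\<^sup>2 \<le> (L * norm (x - xstar))\<^sup>2"
    using gap[of x] by linarith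
  then show ?thesis
    by (rule power2_le_imp_le) (use \<open>L > 0\<close> in simp)
qed

section \<open>The Caputo gradient as an inexact gradient\<close>

text \<open>
  Each coordinate is the one-dimensional estimate for the restriction \<open>t \<mapsto> f (p t)\<close> to a coordinate
  line, whose derivative inherits the increment bounds of the gradient.
\<close>
lemma caputo_grad_near_gradient:
  fixes f :: "real ^ 'k \<Rightarrow> real"
  assumes twice: "twice_differentiable f" and smooth: "L_smooth L f" and convex: "convex_on UNIV f"
    and \<alpha>: "0 < \<alpha>" "\<alpha> < 1"
    and \<gamma>: "\<gamma> = (1 - \<alpha>) / (2 - \<alpha>)"
    and K1: "K1 = L / 2 * (\<beta> - \<gamma>)"
    and K2: "K2 = (if \<beta> \<ge> 0 then L / 2 * (\<beta> + \<gamma>) else - (L / 2) * (\<beta> - \<gamma>))"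
    and "K2 \<ge> 0"
  shows "norm (caputo_grad \<alpha> \<beta> c f x - (grad f x + K1 *\<^sub>R (x - c))) \<le> K2 * norm (x - c)"
proof -
  have G: "GDERIV f z :> grad f z" for z
    using twice by (intro gderiv_grad) (simp add: twice_differentiable_def)
  have "\<bar>(caputo_grad \<alpha> \<beta> c f x - (grad f x + K1 *\<^sub>R (x - c))) $ j\<bar> \<le> \<bar>(K2 *\<^sub>R (x - c)) $ j\<bar>" for j
  proof -
    let ?e = "axis j 1 :: real ^ 'k"
    define p where "p t = x + (t - x $ j) *\<^sub>R ?e" for t
    define g' where "g' t = ?e \<bullet> grad f (p t)" for t
    have g': "((\<lambda>t. f (p t)) has_real_derivative g' t) (at t)" for t
      unfolding p_def g'_def by (intro has_real_derivative_along_line G)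
    have g'': "(g' has_real_derivative deriv g' t) (at t)" for t
    proof -
      have "grad f differentiable at (p t)"
        using twice by (simp add: twice_differentiable_def)
      moreover have "p differentiable at t"
        unfolding p_def by (intro derivative_intros differentiable_add differentiable_scaleR)
      ultimately have "(\<lambda>t. grad f (p t)) differentiable at t"
        by (rule differentiable_compose)
      then have "g' differentiable at t"
        unfolding g'_def by (intro differentiable_inner) auto
      then show ?thesis
        by (simp add: DERIV_deriv_iff_real_differentiable)
    qed
    have inc: "0 \<le> (g' r - g' s) * (r - s) \<and> (g' r - g' s) * (r - s) \<le> L * (r - s)\<^sup>2" for r s
    proof -
      have p: "p r - p s = (r - s) *\<^sub>R ?e"
        by (simp add: p_def algebra_simps)
      have "(g' r - g' s) * (r - s) = (grad f (p r) - grad f (p s)) \<bullet> (p r - p s)"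
        unfolding p by (simp add: g'_def inner_diff_left inner_commute algebra_simps)
      moreover have "norm (p r - p s) = \<bar>r - s\<bar>"
        unfolding p by simp
      ultimately show ?thesis
        using gradient_increment_bounds[OF convex smooth G, of "p r" "p s"] by simp
    qed
    have "g' (x $ j) = grad f x $ j"
      by (simp add: g'_def p_def inner_axis inner_commute)
    then show ?thesis
      using caputo_delta_near_derivative[OF \<alpha> g' g'' inc \<gamma> K1 K2, of "c $ j" "x $ j"] \<open>K2 \<ge> 0\<close>
      by (simp add: caputo_grad_def p_def abs_mult)
  qed
  then have "norm (caputo_grad \<alpha> \<beta> c f x - (grad f x + K1 *\<^sub>R (x - c))) \<le> norm (K2 *\<^sub>R (x - c))"
    by (intro norm_le_componentwise_cart) (simp only: real_norm_def)
  then show ?thesis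
    using \<open>K2 \<ge> 0\<close> by simp
qed

section \<open>Descent with an inexact gradient\<close>

text \<open>
  Expanding \<open>D (x - \<eta> d)\<close> expresses \<open>d \<bullet> (x - xstar)\<close>, and hence \<open>a * (f x - f xstar)\<close> by convexity,
  through the decrease of the squared distance; smoothness bounds the change of \<open>f\<close> along the step.
  With \<open>g \<bullet> d \<ge> (a - b) (norm g)\<^sup>2\<close> and \<open>norm d \<le> (a + b) norm g\<close> for \<open>g = grad f x\<close>, the resulting
  bound on \<open>a * (f (x - \<eta> d) - f xstar)\<close> contains \<open>(norm g)\<^sup>2\<close> with the coefficient
  \<open>\<eta> / 2 * ((1 + a * L * \<eta>) * (a + b)\<^sup>2 - 2 * a * (a - b))\<close>, which is zero for the prescribed \<open>\<eta>\<close>.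
\<close>
lemma inexact_gradient_step:
  fixes f :: "'a::real_inner \<Rightarrow> real" and d xstar :: 'a
  defines "D \<equiv> \<lambda>z. (norm (z - xstar))\<^sup>2"
  assumes smooth: "L_smooth L f"
    and tangent: "f x + grad f x \<bullet> (xstar - x) \<le> f xstar"
    and grad: "norm (grad f x) \<le> L * norm (x - xstar)"
    and "L > 0" "a > 0" "b \<ge> 0"
    and d: "norm (d - a *\<^sub>R grad f x) \<le> b * norm (grad f x)"
    and \<eta>: "\<eta> = 1 / L * (2 * (a - b) / (a + b)\<^sup>2 - 1 / a)" and "\<eta> > 0"
  shows "f (x - \<eta> *\<^sub>R d) - f xstar \<le> (D x - D (x - \<eta> *\<^sub>R d)) / (2 * \<eta> * a) + b / a * L * D x"
proof -
  let ?g = "grad f x"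
  define N where "N = (norm ?g)\<^sup>2"
  define dd where "dd = (norm d)\<^sup>2"
  define Dp where "Dp = D (x - \<eta> *\<^sub>R d)"
  have "\<bar>?g \<bullet> (d - a *\<^sub>R ?g)\<bar> \<le> norm ?g * (b * norm ?g)"
    using d by (intro order_trans[OF Cauchy_Schwarz_ineq2] mult_left_mono) auto
  then have gd: "?g \<bullet> d \<ge> (a - b) * N"
    by (simp add: N_def inner_diff_right power2_norm_eq_inner[symmetric] power2_eq_square algebra_simps abs_le_iff)
  have "norm d \<le> norm (d - a *\<^sub>R ?g) + norm (a *\<^sub>R ?g)"
    by (metis diff_add_cancel norm_triangle_ineq)
  with d \<open>a > 0\<close> have "norm d \<le> (a + b) * norm ?g"
    by (simp add: algebra_simps)
  then have "dd \<le> ((a + b) * norm ?g)\<^sup>2"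
    unfolding dd_def by (intro power_mono) auto
  then have dd: "dd \<le> (a + b)\<^sup>2 * N"
    by (simp add: N_def power_mult_distrib)
  have "\<bar>(d - a *\<^sub>R ?g) \<bullet> (x - xstar)\<bar> \<le> norm (d - a *\<^sub>R ?g) * norm (x - xstar)"
    by (rule Cauchy_Schwarz_ineq2)
  also have "\<dots> \<le> b * (L * norm (x - xstar)) * norm (x - xstar)"
    using d grad \<open>b \<ge> 0\<close> by (intro mult_right_mono order_trans[OF d] mult_left_mono) auto
  also have "\<dots> = b * L * D x"
    by (simp add: D_def power2_eq_square)
  finally have "d \<bullet> (x - xstar) \<ge> a * (?g \<bullet> (x - xstar)) - b * L * D x"
    by (simp add: inner_diff_left abs_le_iff)
  moreover have "a * (?g \<bullet> (x - xstar)) \<ge> a * (f x - f xstar)"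
    using tangent \<open>a > 0\<close> by (intro mult_left_mono) (auto simp: inner_diff_right)
  moreover have "Dp = D x - 2 * \<eta> * (d \<bullet> (x - xstar)) + \<eta>\<^sup>2 * dd"
    unfolding Dp_def D_def dd_def power2_norm_eq_inner
    by (simp add: inner_diff_left inner_diff_right inner_commute power2_eq_square algebra_simps)
  then have "d \<bullet> (x - xstar) = (D x - Dp) / (2 * \<eta>) + \<eta> * dd / 2"
    using \<open>\<eta> > 0\<close> by (simp add: field_simps power2_eq_square)
  ultimately have A: "a * (f x - f xstar) \<le> (D x - Dp) / (2 * \<eta>) + \<eta> * dd / 2 + b * L * D x"
    by linarith
  have "f (x - \<eta> *\<^sub>R d) \<le> f x - \<eta> * (?g \<bullet> d) + L / 2 * (\<eta>\<^sup>2 * dd)"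
    using L_smooth_upper[OF smooth, of "x - \<eta> *\<^sub>R d" x] by (simp add: dd_def power_mult_distrib)
  also have "\<dots> \<le> f x - \<eta> * ((a - b) * N) + L / 2 * (\<eta>\<^sup>2 * dd)"
    using gd \<open>\<eta> > 0\<close> by simp
  finally have "a * (f (x - \<eta> *\<^sub>R d) - f x) \<le> a * (- \<eta> * ((a - b) * N) + L / 2 * (\<eta>\<^sup>2 * dd))"
    using \<open>a > 0\<close> by (intro mult_left_mono) auto
  with A have "a * (f (x - \<eta> *\<^sub>R d) - f xstar) \<le> (D x - Dp) / (2 * \<eta>) + b * L * D x
      + \<eta> / 2 * ((1 + a * L * \<eta>) * dd - 2 * a * (a - b) * N)"
    by (simp add: algebra_simps power2_eq_square)
  moreover have "(1 + a * L * \<eta>) * dd \<le> (1 + a * L * \<eta>) * ((a + b)\<^sup>2 * N)"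
    using dd \<open>a > 0\<close> \<open>L > 0\<close> \<open>\<eta> > 0\<close> by (intro mult_left_mono) auto
  \<comment> \<open>This identity determines \<open>\<eta>\<close>.\<close>
  moreover have "(1 + a * L * \<eta>) * (a + b)\<^sup>2 = 2 * a * (a - b)"
    using \<open>a > 0\<close> \<open>b \<ge> 0\<close> \<open>L > 0\<close> by (simp add: \<eta> right_diff_distrib)
  then have "(1 + a * L * \<eta>) * ((a + b)\<^sup>2 * N) = 2 * a * (a - b) * N"
    by (simp add: mult.assoc[symmetric])
  ultimately have "\<eta> / 2 * ((1 + a * L * \<eta>) * dd - 2 * a * (a - b) * N) \<le> 0"
    "a * (f (x - \<eta> *\<^sub>R d) - f xstar) \<le> (D x - Dp) / (2 * \<eta>) + b * L * D x
      + \<eta> / 2 * ((1 + a * L * \<eta>) * dd - 2 * a * (a - b) * N)"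
    using \<open>\<eta> > 0\<close> by (auto simp: mult_le_0_iff)
  then have "a * (f (x - \<eta> *\<^sub>R d) - f xstar) \<le> (D x - Dp) / (2 * \<eta>) + b * L * D x"
    by linarith
  then have "f (x - \<eta> *\<^sub>R d) - f xstar \<le> ((D x - Dp) / (2 * \<eta>) + b * L * D x) / a"
    using \<open>a > 0\<close> by (simp add: pos_le_divide_eq mult.commute)
  also have "\<dots> = (D x - Dp) / (2 * \<eta> * a) + b / a * L * D x"
    by (simp add: add_divide_distrib)
  finally show ?thesis
    unfolding Dp_def .
qed

section \<open>The convergence rate\<close>

lemma telescoping_sum_le:
  fixes e A B D :: "nat \<Rightarrow> real"
  assumes "\<And>t. e t \<le> A t * D t - B t * D (Suc t)" "\<And>t. A (Suc t) \<le> B t" "\<And>t. 0 \<le> D t"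
  shows "(\<Sum>t\<le>n. e t) \<le> A 0 * D 0 - B n * D (Suc n)"
proof (induction n)
  case (Suc n)
  have "A (Suc n) * D (Suc n) \<le> B n * D (Suc n)"
    using assms by (intro mult_right_mono)
  then show ?case
    using Suc assms(1)[of "Suc n"] by simp
qed (use assms in simp)

lemma convex_on_average_le:
  fixes f :: "'a::real_vector \<Rightarrow> real"
  assumes "convex_on UNIV f" "finite I" "I \<noteq> {}"
  shows "f ((1 / real (card I)) *\<^sub>R (\<Sum>i\<in>I. x i)) \<le> (\<Sum>i\<in>I. f (x i)) / real (card I)"
  using convex_on_sum[of I UNIV f "\<lambda>_. 1 / real (card I)" x] assms
  by (simp add: scaleR_right.sum sum_divide_distrib)

text \<open>
  The larger root of \<open>s\<^sup>2 - 4 * s - 1\<close> is \<open>2 + sqrt 5\<close>; beyond it the step size is positive.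
\<close>
lemma step_parameter_bounds:
  fixes s :: real
  assumes "s > sqrt 5 + 2"
  shows "s > 0" "s\<^sup>2 - 4 * s - 1 > 0" "1 \<le> (s + 1)\<^sup>2 / (s\<^sup>2 - 4 * s - 1)"
proof -
  have "sqrt 5 > 0" by simp
  with assms show s: "s > 0" by linarith
  have "(sqrt 5)\<^sup>2 < (s - 2)\<^sup>2"
    using assms by (intro power_strict_mono) auto
  then show q: "s\<^sup>2 - 4 * s - 1 > 0"
    by (simp add: power2_eq_square algebra_simps)
  show "1 \<le> (s + 1)\<^sup>2 / (s\<^sup>2 - 4 * s - 1)"
    using s q by (simp add: le_divide_eq) (simp add: power2_eq_square algebra_simps)
qed

lemma step_size_eq:
  fixes a b s L :: real
  assumes "a = s * b" "a > 0" "s > 0"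
  shows "1 / L * (2 * (a - b) / (a + b)\<^sup>2 - 1 / a) = 1 / (L * a) * ((s\<^sup>2 - 4 * s - 1) / (s + 1)\<^sup>2)"
proof -
  have b: "b = a / s"
    using assms by simp
  have ab: "a - b = a * (s - 1) / s" "a + b = a * (s + 1) / s"
    using assms(3) by (simp_all add: b field_simps)
  have "2 * (a - b) / (a + b)\<^sup>2 - 1 / a = 1 / a * (2 * s * (s - 1) / (s + 1)\<^sup>2 - 1)"
    unfolding ab using assms(2,3)
    by (simp add: divide_simps power2_eq_square)
  also have "2 * s * (s - 1) / (s + 1)\<^sup>2 - 1 = (2 * s * (s - 1) - (s + 1)\<^sup>2) / (s + 1)\<^sup>2"
    using assms(3) by (simp add: diff_divide_distrib)
  also have "2 * s * (s - 1) - (s + 1)\<^sup>2 = s\<^sup>2 - 4 * s - 1"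
    by (simp add: power2_eq_square algebra_simps)
  finally show ?thesis
    by simp
qed

theorem theorem5p2:
  fixes f :: "real ^ 'k \<Rightarrow> real"
    and xstar :: "real ^ 'k"
    and x c :: "nat \<Rightarrow> real ^ 'k"
    and s lam \<eta> :: "nat \<Rightarrow> real"
    and L \<alpha> \<beta> \<gamma> K1 K2 :: real
  assumes "twice_differentiable f"
    and "L > 0"
    and "L_smooth L f"
    and "convex_on UNIV f"
    and "\<And>y. f xstar \<le> f y"
    and "0 < \<alpha>" and "\<alpha> < 1"
    and "\<gamma> = (1 - \<alpha>) / (2 - \<alpha>)"
    and "K1 = L / 2 * (\<beta> - \<gamma>)"
    and "K2 = (if \<beta> \<ge> 0 then L / 2 * (\<beta> + \<gamma>) else - (L / 2) * (\<beta> - \<gamma>))"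
    and "s 0 > sqrt 5 + 2"
    and "\<And>t. s (Suc t) > sqrt 5 + 2"
    and "\<And>t. (s (Suc t) + 1)\<^sup>2 / ((s (Suc t))\<^sup>2 - 4 * s (Suc t) - 1) + 2 / s (Suc t)
              \<le> (s t + 1)\<^sup>2 / ((s t)\<^sup>2 - 4 * s t - 1)"
    and "\<And>t. 1 - lam t * K1 = s t * \<bar>lam t\<bar> * K2"
    and "\<And>t. \<eta> t = 1 / L * (2 * (1 - lam t * K1 - \<bar>lam t\<bar> * K2)
                               / (1 - lam t * K1 + \<bar>lam t\<bar> * K2)\<^sup>2
                             - 1 / (1 - lam t * K1))"
    and "\<And>t. x t - c t = - (lam t *\<^sub>R grad f (x t))"
    and "\<And>t. x (Suc t) = x t - \<eta> t *\<^sub>R caputo_grad \<alpha> \<beta> (c t) f (x t)"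
  shows "(\<forall>t. \<eta> t = 1 / (L * (1 - lam t * K1))
                     * (((s t)\<^sup>2 - 4 * s t - 1) / (s t + 1)\<^sup>2))
       \<and> (\<forall>T\<ge>1. f ((1 / real T) *\<^sub>R (\<Sum>t=1..T. x t)) - f xstar
              \<le> L / 2 * ((s 0 + 1)\<^sup>2 / ((s 0)\<^sup>2 - 4 * s 0 - 1) + 2 / s 0)
                  * ((norm (x 0 - xstar))\<^sup>2 / real T))
       \<and> L / 2 \<le> L / 2 * ((s 0 + 1)\<^sup>2 / ((s 0)\<^sup>2 - 4 * s 0 - 1) + 2 / s 0)"
proof -
  note smooth = assms(3) and convex = assms(4) and \<gamma> = assms(8) and K1 = assms(9) and K2 = assms(10)
    and \<eta> = assms(15)
  have "\<gamma> > 0"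
    using assms(6,7) by (simp add: \<gamma>)
  then have "K2 > 0"
    using \<open>L > 0\<close> by (auto simp: K2 mult_pos_neg)
  have "s t > sqrt 5 + 2" for t
    using assms(11,12) by (cases t) auto
  note s = step_parameter_bounds[OF this]
  define a where "a t = 1 - lam t * K1" for t
  define b where "b t = \<bar>lam t\<bar> * K2" for t
  define R where "R t = (s t + 1)\<^sup>2 / ((s t)\<^sup>2 - 4 * s t - 1)" for t
  define D where "D t = (norm (x t - xstar))\<^sup>2" for t
  have ab: "a t = s t * b t" for t
    using assms(14) by (simp add: a_def b_def)
  \<comment> \<open>For \<open>lam t = 0\<close> the relation that defines \<open>lam t\<close> would read \<open>1 = 0\<close>.\<close>
  have "lam t \<noteq> 0" for t
    using assms(14)[of t] by auto
  then have b: "b t > 0" for t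
    using \<open>K2 > 0\<close> by (simp add: b_def)
  then have a: "a t > 0" for t
    using s(1) by (simp add: ab)
  have \<eta>_ab: "\<eta> t = 1 / L * (2 * (a t - b t) / (a t + b t)\<^sup>2 - 1 / a t)" for t
    unfolding a_def b_def by (rule \<eta>)
  have \<eta>_s: "\<eta> t = 1 / (L * a t) * (((s t)\<^sup>2 - 4 * s t - 1) / (s t + 1)\<^sup>2)" for t
    unfolding \<eta>_ab by (rule step_size_eq[OF ab a s(1)])
  have \<eta>_pos: "\<eta> t > 0" for t
    unfolding \<eta>_s using \<open>L > 0\<close> a[of t] s(1,2)[of t] by (intro mult_pos_pos divide_pos_pos) auto
  have G: "GDERIV f z :> grad f z" for z
    using assms(1) by (intro gderiv_grad) (simp add: twice_differentiable_def)
  have direction: "norm (caputo_grad \<alpha> \<beta> (c t) f (x t) - a t *\<^sub>R grad f (x t)) \<le> b t * norm (grad f (x t))" for t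
    using caputo_grad_near_gradient[OF assms(1) smooth convex assms(6,7) \<gamma> K1 K2, of "c t" "x t"]
      \<open>K2 > 0\<close> by (simp add: assms(16) a_def b_def algebra_simps)
  have step: "f (x (Suc t)) - f xstar \<le> (L / 2 * (R t + 2 / s t)) * D t - (L / 2 * R t) * D (Suc t)" for t
  proof -
    have "f (x (Suc t)) - f xstar \<le> (D t - D (Suc t)) / (2 * \<eta> t * a t) + b t / a t * L * D t"
      unfolding assms(17) D_def
      using smooth convex_above_tangent_plane[OF convex G]
        norm_grad_le_dist_minimizer[OF \<open>L > 0\<close> smooth assms(5)] \<open>L > 0\<close> a less_imp_le[OF b] direction \<eta>_ab \<eta>_pos
      by (rule inexact_gradient_step)
    \<comment> \<open>The factor \<open>a t\<close> in \<open>\<eta> t\<close> cancels, leaving \<open>2 * \<eta> t * a t = 2 / (L * R t)\<close>.\<close>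
    also have "2 * \<eta> t * a t = 2 / (L * R t)"
      using a[of t] by (simp add: \<eta>_s R_def)
    also have "(D t - D (Suc t)) / (2 / (L * R t)) = L / 2 * R t * (D t - D (Suc t))"
      using \<open>L > 0\<close> by simp
    also have "b t / a t = 1 / s t"
      using b[of t] s(1)[of t] by (simp add: ab)
    finally show ?thesis
      by (simp add: algebra_simps add_divide_distrib diff_divide_distrib)
  qed
  have recursion: "L / 2 * (R (Suc t) + 2 / s (Suc t)) \<le> L / 2 * R t" for t
    using assms(13)[of t] \<open>L > 0\<close> unfolding R_def by (intro mult_left_mono) auto
  have rate: "f ((1 / real T) *\<^sub>R (\<Sum>t=1..T. x t)) - f xstar
      \<le> L / 2 * (R 0 + 2 / s 0) * (D 0 / real T)" if T: "T \<ge> 1" for T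
  proof -
    obtain n where n: "T = Suc n"
      using T not0_implies_Suc[of T] by auto
    have "f ((1 / real T) *\<^sub>R (\<Sum>t=1..T. x t)) \<le> (\<Sum>t=1..T. f (x t)) / real T"
      using convex_on_average_le[OF convex, of "{1..T}" x] T by simp
    also have "\<dots> = (\<Sum>t\<le>n. f (x (Suc t)) - f xstar) / real T + f xstar"
      by (simp add: n sum_subtractf diff_divide_distrib sum.atLeast1_atMost_eq lessThan_Suc_atMost[symmetric])
    also have "(\<Sum>t\<le>n. f (x (Suc t)) - f xstar) \<le> (L / 2 * (R 0 + 2 / s 0)) * D 0 - (L / 2 * R n) * D (Suc n)"
      using step recursion by (rule telescoping_sum_le) (simp add: D_def)
    also have "\<dots> \<le> (L / 2 * (R 0 + 2 / s 0)) * D 0"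
    proof -
      have "0 \<le> R n" "0 \<le> D (Suc n)"
        using s(3)[of n] by (simp_all add: R_def D_def)
      then have "0 \<le> (L / 2 * R n) * D (Suc n)"
        using \<open>L > 0\<close> by (intro mult_nonneg_nonneg) auto
      then show ?thesis
        by linarith
    qed
    finally show ?thesis
      by (simp add: divide_right_mono)
  qed
  have "1 \<le> R 0 + 2 / s 0"
    using s(1,3)[of 0] by (simp add: R_def add_increasing2)
  then have "L / 2 * 1 \<le> L / 2 * (R 0 + 2 / s 0)"
    using \<open>L > 0\<close> by (intro mult_left_mono) auto
  then show ?thesis
    using \<eta>_s rate unfolding a_def R_def D_def by auto
qed

end
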